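(* Let $\{a_n\}_{n\in\mathbb{N}},\{b_m\}_{m\in\mathbb{N}}\subset\mathbb{N}$ be (strictly) increasing sequences satisfying $\lim_{n\to\infty}a_{n+1}/a_n=1$ and $\lim_{m\to\infty}b_{m+1}/b_m=1$, and let $\{c_k\}_{k\in\mathbb{N}}$ be any unbounded sequence of integers. Then for every irrational real number $x$, the set $\{a_nb_mc_kx : n,m,k\in\mathbb{N}\}$ is dense modulo $1$.
   Context: $\mathbb{N}$ denotes the positive integers. A set of real numbers is dense modulo $1$ if its image in $\mathbb{R}/\mathbb{Z}$ is dense. A sequence of integers is unbounded if the absolute values of its terms are unbounded. *)

theory Defs
  imports "HOL-Analysis.Analysis"
begin

definition mod1_rel :: "(real \<times> real) set"
  where "mod1_rel = {(x, y). x - y \<in> \<int>}"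

definition mod1_class :: "real \<Rightarrow> real set"
  where "mod1_class x = mod1_rel `` {x}"

text \<open>The space \<open>\<real>/\<int>\<close> with the quotient topology. Its points are the classes of \<^const>\<open>mod1_rel\<close>,
  so the preimage in \<open>\<real>\<close> of a set \<open>U\<close> of points is \<open>\<Union>U\<close>.\<close>

definition mod1_topology :: "real set topology"
  where "mod1_topology = topology (\<lambda>U. U \<subseteq> UNIV // mod1_rel \<and> open (\<Union>U))"

definition dense_mod1 :: "real set \<Rightarrow> bool"
  where "dense_mod1 A \<longleftrightarrow>
    mod1_topology closure_of (mod1_class ` A) = topspace mod1_topology"

lemma equiv_mod1_rel: "equiv UNIV mod1_rel"
proof (rule equivI)
  show "sym mod1_rel"
    by (metis (mono_tags, lifting) Ints_minus case_prodD case_prodI mem_Collect_eq minus_diff_eq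
        mod1_rel_def symI)
  show "trans mod1_rel"
    unfolding mod1_rel_def trans_def by (auto dest: Ints_add)
qed (auto simp: mod1_rel_def refl_on_def)

lemma quotient_mod1_rel: "UNIV // mod1_rel = range mod1_class"
  by (auto simp: quotient_def mod1_class_def)

lemma mod1_class_eq_iff: "mod1_class x = mod1_class y \<longleftrightarrow> x - y \<in> \<int>"
  unfolding mod1_class_def using eq_equiv_class_iff[OF equiv_mod1_rel, of x y]
  by (simp add: mod1_rel_def)

lemma mem_mod1_class: "y \<in> mod1_class x \<longleftrightarrow> x - y \<in> \<int>"
  by (simp add: mod1_class_def mod1_rel_def)

lemma Union_mod1:
  assumes "U \<subseteq> UNIV // mod1_rel"
  shows "\<Union>U = mod1_class -` U"
proof -
  have "y \<in> mod1_class x \<longleftrightarrow> mod1_class x = mod1_class y" for x y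
    by (simp add: mem_mod1_class mod1_class_eq_iff)
  then show ?thesis
    using assms unfolding quotient_mod1_rel by (fastforce simp: subset_iff)
qed

lemma openin_mod1_topology:
  "openin mod1_topology U \<longleftrightarrow> U \<subseteq> UNIV // mod1_rel \<and> open (\<Union>U)"
proof -
  have "istopology (\<lambda>U. U \<subseteq> UNIV // mod1_rel \<and> open (\<Union>U))"
    unfolding istopology_def
  proof (intro conjI allI impI)
    fix S T
    assume S: "S \<subseteq> UNIV // mod1_rel \<and> open (\<Union>S)" and T: "T \<subseteq> UNIV // mod1_rel \<and> open (\<Union>T)"
    then show "S \<inter> T \<subseteq> UNIV // mod1_rel" by blast
    then have "\<Union>(S \<inter> T) = \<Union>S \<inter> \<Union>T"
      using S T by (simp add: Union_mod1)
    then show "open (\<Union>(S \<inter> T))" using S T by auto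
  next
    fix \<K> :: "real set set set"
    assume K: "\<forall>K\<in>\<K>. K \<subseteq> UNIV // mod1_rel \<and> open (\<Union>K)"
    then show "\<Union>\<K> \<subseteq> UNIV // mod1_rel" by blast
    have "\<Union>(\<Union>\<K>) = (\<Union>K\<in>\<K>. \<Union>K)" by blast
    then show "open (\<Union>(\<Union>\<K>))" using K by auto
  qed
  then show ?thesis
    by (simp add: mod1_topology_def topology_inverse')
qed

lemma topspace_mod1_topology: "topspace mod1_topology = UNIV // mod1_rel"
proof -
  have "openin mod1_topology (UNIV // mod1_rel)"
    using Union_quotient[OF equiv_mod1_rel] by (simp add: openin_mod1_topology)
  then show ?thesis
    by (metis openin_mod1_topology openin_subset openin_topspace subset_antisym)
qed

lemma quotient_map_mod1_class: "quotient_map euclidean mod1_topology mod1_class"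
  unfolding quotient_map_def
  by (auto simp: topspace_mod1_topology quotient_mod1_rel openin_mod1_topology
      Union_mod1 vimage_def)

lemma dense_mod1_iff:
  "dense_mod1 A \<longleftrightarrow> (\<forall>y. \<forall>e>0. \<exists>a\<in>A. \<exists>k::int. \<bar>a - y - of_int k\<bar> < e)"
proof -
  have *: "dense_mod1 A \<longleftrightarrow>
      (\<forall>y U. mod1_class y \<in> U \<and> openin mod1_topology U \<longrightarrow> (\<exists>a\<in>A. mod1_class a \<in> U))"
    unfolding dense_mod1_def set_eq_iff in_closure_of topspace_mod1_topology quotient_mod1_rel
    by auto
  show ?thesis
  proof
    assume dense: "dense_mod1 A"
    show "\<forall>y. \<forall>e>0. \<exists>a\<in>A. \<exists>k::int. \<bar>a - y - of_int k\<bar> < e"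
    proof (intro allI impI)
      fix y e :: real assume "e > 0"
      define U where "U = mod1_class ` ball y e"
      have sub: "U \<subseteq> UNIV // mod1_rel" by (auto simp: U_def quotient_mod1_rel)
      have "\<Union>U = (\<Union>k::int. ball (y + of_int k) e)"
      proof (intro set_eqI iffI)
        fix z assume "z \<in> \<Union>U"
        then obtain w where w: "dist y w < e" "w - z \<in> \<int>"
          by (auto simp: U_def mem_mod1_class)
        then obtain k :: int where "w - z = of_int k" by (auto elim: Ints_cases)
        then have "dist (y + of_int (- k)) z < e" using w by (simp add: dist_real_def algebra_simps)
        then show "z \<in> (\<Union>k::int. ball (y + of_int k) e)" by (metis UN_I UNIV_I mem_ball)
      next
        fix z assume "z \<in> (\<Union>k::int. ball (y + of_int k) e)"
        then obtain k :: int where "dist (y + of_int k) z < e" by auto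
        then have "z - of_int k \<in> ball y e" by (simp add: dist_real_def algebra_simps)
        moreover have "z \<in> mod1_class (z - of_int k)" by (simp add: mem_mod1_class)
        ultimately show "z \<in> \<Union>U" by (auto simp: U_def)
      qed
      then have "openin mod1_topology U" using sub by (auto simp: openin_mod1_topology)
      moreover have "mod1_class y \<in> U" using \<open>e > 0\<close> by (auto simp: U_def)
      ultimately obtain a where a: "a \<in> A" "mod1_class a \<in> U" using dense * by blast
      then obtain w where w: "dist y w < e" "a - w \<in> \<int>"
        by (auto simp: U_def mod1_class_eq_iff)
      then obtain k :: int where "a - w = of_int k" by (auto elim: Ints_cases)
      then have "\<bar>a - y - of_int k\<bar> < e" using w by (simp add: dist_real_def algebra_simps)
      then show "\<exists>a\<in>A. \<exists>k::int. \<bar>a - y - of_int k\<bar> < e" using a by blast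
    qed
  next
    assume R: "\<forall>y. \<forall>e>0. \<exists>a\<in>A. \<exists>k::int. \<bar>a - y - of_int k\<bar> < e"
    show "dense_mod1 A"
      unfolding *
    proof (intro allI impI, elim conjE)
      fix y U assume y: "mod1_class y \<in> U" and U: "openin mod1_topology U"
      then have o: "open (mod1_class -` U)" by (metis Union_mod1 openin_mod1_topology)
      then obtain e where e: "e > 0" "ball y e \<subseteq> mod1_class -` U"
        using y by (meson openE vimageI2)
      then obtain a and k :: int where a: "a \<in> A" "\<bar>a - y - of_int k\<bar> < e" using R by blast
      then have "a - of_int k \<in> ball y e" by (simp add: dist_real_def algebra_simps)
      then have "mod1_class (a - of_int k) \<in> U" using e by blast
      moreover have "mod1_class (a - of_int k) = mod1_class a" by (simp add: mod1_class_eq_iff)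
      ultimately show "\<exists>a\<in>A. mod1_class a \<in> U" using a by auto
    qed
  qed
qed

end

theory Submission
  imports Defs
begin

text \<open>Write \<open>Y\<close> for the set of all \<open>a\<^sub>n c\<^sub>k x\<close>. Two of the numbers \<open>c\<^sub>k x\<close> differ modulo 1 by an
  arbitrarily small \<open>\<eta> > 0\<close>, and the multiples \<open>a\<^sub>n \<eta>\<close> run through the reals in small steps; so
  \<open>Y - Y\<close> is dense modulo 1. Hence at least about \<open>\<surd>N\<close> of the \<open>N\<close> cells of length \<open>1/N\<close> meet \<open>Y\<close>, and by
  counting there are arbitrarily deep \<open>D\<close>-adic cells of which many of the \<open>D\<close> children meet \<open>Y\<close>.
  Among points of \<open>Y\<close> in these children one finds a point \<open>y\<^sub>0\<close> and points \<open>y\<^sub>i\<close> whose distances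
  from \<open>y\<^sub>0\<close> are lacunary, with ratios bounded in terms of \<open>D\<close>. By a nested interval argument there is
  an interval of dilations \<open>r\<close>, wide enough to contain a suitable \<open>b\<^sub>m\<close>, for which the
  \<open>r (y\<^sub>i - y\<^sub>0)\<close> are close modulo 1 to prescribed equidistant values.\<close>

section \<open>Density modulo 1 of the differences of points of \<open>Y\<close>\<close>

text \<open>The first term that reaches \<open>u\<close> has a predecessor below \<open>u\<close>,
  and far out one step multiplies by less than \<open>1 + e\<close>.\<close>

lemma slowly_growing_hits:
  fixes a :: "nat \<Rightarrow> nat" and e :: real
  assumes pos: "\<And>n. n \<ge> 1 \<Longrightarrow> a n \<ge> 1" and mono: "strict_mono_on {1..} a"
    and lim: "(\<lambda>n. real (a (n + 1)) / real (a n)) \<longlonglongrightarrow> 1" and "e > 0"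
  obtains M where "\<And>u. u \<ge> M \<Longrightarrow> \<exists>n\<ge>1. u \<le> real (a n) \<and> real (a n) \<le> (1 + e) * u"
proof -
  have "eventually (\<lambda>n. real (a (n + 1)) / real (a n) < 1 + e) sequentially"
    using order_tendstoD(2)[OF lim, of "1 + e"] \<open>e > 0\<close> by simp
  then obtain N0 where N0: "\<And>n. n \<ge> N0 \<Longrightarrow> real (a (n + 1)) / real (a n) < 1 + e"
    by (auto simp: eventually_sequentially)
  define N where "N = max N0 1"
  have step: "real (a (n + 1)) \<le> (1 + e) * real (a n)" if "n \<ge> N" for n
  proof -
    have "real (a n) > 0" using pos[of n] that by (simp add: N_def)
    then show ?thesis using N0[of n] that by (simp add: N_def divide_simps)
  qed
  have ge: "n \<le> a n" if "n \<ge> 1" for n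
    using that
  proof (induction n rule: nat_induct_at_least)
    case base then show ?case using pos[of 1] by simp
  next
    case (Suc n)
    then have "a n < a (Suc n)" using mono by (auto simp: strict_mono_on_def)
    then show ?case using Suc by simp
  qed
  \<comment> \<open>The \<open>+ 1\<close> keeps \<open>a N\<close> below \<open>u\<close>, so the
    least index has a predecessor that is still at least \<open>N\<close>.\<close>
  show ?thesis
  proof (rule that[of "real (a N) + 1"])
    fix u :: real assume u: "u \<ge> real (a N) + 1"
    define P where "P = (\<lambda>n. n \<ge> N \<and> u \<le> real (a n))"
    have "P (max N (nat \<lceil>u\<rceil>))"
      using ge[of "max N (nat \<lceil>u\<rceil>)"] unfolding P_def N_def by linarith
    then have PL: "P (Least P)" by (rule LeastI)
    then have "Least P \<noteq> N" using u by (auto simp: P_def)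
    with PL have "Least P > N" by (auto simp: P_def)
    then obtain n where n: "Least P = Suc n" "n \<ge> N" by (cases "Least P") (auto simp: less_Suc_eq_le)
    then have "\<not> P n" using not_less_Least[of n P] by simp
    then have "real (a n) \<le> u" using n by (auto simp: P_def)
    then have "(1 + e) * real (a n) \<le> (1 + e) * u" using \<open>e > 0\<close> by (intro mult_left_mono) auto
    then have "real (a (Suc n)) \<le> (1 + e) * u" using step[OF n(2)] by simp
    then show "\<exists>n\<ge>1. u \<le> real (a n) \<and> real (a n) \<le> (1 + e) * u"
      using PL n by (intro exI[of _ "Suc n"]) (auto simp: P_def)
  qed
qed

text \<open>Pigeonhole: the fractional parts of infinitely many multiples of \<open>x\<close> fall
  into finitely many intervals of length \<open>\<delta>\<close>. Irrationality makes the resulting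
  difference nonzero, and exchanging \<open>k\<close> and \<open>l\<close> corrects its
  sign.\<close>

lemma small_differences_mod1:
  fixes Z :: "int set" and x :: real
  assumes "infinite Z" "x \<notin> \<rat>" "\<delta> > 0"
  obtains k l j where "k \<in> Z" "l \<in> Z"
    "0 < of_int k * x - of_int l * x - of_int j" "of_int k * x - of_int l * x - of_int j < \<delta>"
proof -
  define f where "f = (\<lambda>k::int. \<lfloor>frac (of_int k * x) / \<delta>\<rfloor>)"
  have "f ` Z \<subseteq> {0..\<lfloor>1 / \<delta>\<rfloor>}"
  proof
    fix i assume "i \<in> f ` Z"
    then obtain k where i: "i = f k" by blast
    have "frac (of_int k * x) / \<delta> \<le> 1 / \<delta>"
      using \<open>\<delta> > 0\<close> less_imp_le[OF frac_lt_1] by (intro divide_right_mono) auto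
    then show "i \<in> {0..\<lfloor>1 / \<delta>\<rfloor>}" using \<open>\<delta> > 0\<close> by (simp add: i f_def floor_mono)
  qed
  then have "finite (f ` Z)" by (rule finite_subset) simp
  then have "\<not> inj_on f Z" using \<open>infinite Z\<close> by (auto dest: finite_imageD)
  then obtain k l where kl: "k \<in> Z" "l \<in> Z" "k \<noteq> l" "f k = f l" by (auto simp: inj_on_def)
  define \<eta> where "\<eta> = frac (of_int k * x) - frac (of_int l * x)"
  have eta: "\<eta> = of_int k * x - of_int l * x - of_int (\<lfloor>of_int k * x\<rfloor> - \<lfloor>of_int l * x\<rfloor>)"
    by (simp add: \<eta>_def frac_def)
  have "\<bar>frac (of_int k * x) / \<delta> - frac (of_int l * x) / \<delta>\<bar> < 1"
    using kl(4) unfolding f_def by linarith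
  then have small: "\<bar>\<eta>\<bar> < \<delta>"
    using \<open>\<delta> > 0\<close> by (simp add: \<eta>_def diff_divide_distrib[symmetric] abs_divide divide_simps)
  have "\<eta> \<noteq> 0"
  proof
    assume "\<eta> = 0"
    then have "x = of_int (\<lfloor>of_int k * x\<rfloor> - \<lfloor>of_int l * x\<rfloor>) / of_int (k - l)"
      using kl(3) by (simp add: eta field_simps)
    then have "x \<in> \<rat>" by (metis Rats_divide Rats_of_int)
    then show False using assms(2) by simp
  qed
  then consider "\<eta> > 0" | "\<eta> < 0" by linarith
  then show ?thesis
  proof cases
    case 1
    then show ?thesis
      using that[of k l "\<lfloor>of_int k * x\<rfloor> - \<lfloor>of_int l * x\<rfloor>", folded eta] kl small by simp
  next
    case 2
    have "- \<eta> = of_int l * x - of_int k * x - of_int (\<lfloor>of_int l * x\<rfloor> - \<lfloor>of_int k * x\<rfloor>)"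
      by (simp add: eta)
    from that[of l k "\<lfloor>of_int l * x\<rfloor> - \<lfloor>of_int k * x\<rfloor>", folded this] show ?thesis
      using kl small 2 by simp
  qed
qed

text \<open>Multiplying \<open>k * x - l * x = \<eta> + j\<close> by the integer \<open>a n\<close>
  keeps the error term integral, so only \<open>a n * \<eta>\<close> has to be brought near
  \<open>t\<close> modulo 1.\<close>

lemma differences_dense_mod1:
  fixes a :: "nat \<Rightarrow> nat" and Z :: "int set" and x :: real
  assumes a: "\<And>n. n \<ge> 1 \<Longrightarrow> a n \<ge> 1" "strict_mono_on {1..} a"
      "(\<lambda>n. real (a (n + 1)) / real (a n)) \<longlonglongrightarrow> 1"
    and Z: "infinite Z" "x \<notin> \<rat>" and "e > 0"
  shows "\<exists>n\<ge>1. \<exists>k\<in>Z. \<exists>l\<in>Z. \<exists>j::int.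
    \<bar>real (a n) * of_int k * x - real (a n) * of_int l * x - t - of_int j\<bar> < e"
proof -
  obtain M where M: "\<And>u. u \<ge> M \<Longrightarrow> \<exists>n\<ge>1. u \<le> real (a n) \<and> real (a n) \<le> (1 + e / 3) * u"
    using slowly_growing_hits[OF a, of "e / 3"] \<open>e > 0\<close> by auto
  define \<delta> where "\<delta> = 1 / max M 1"
  have "\<delta> > 0" by (simp add: \<delta>_def)
  then obtain k l j where klj: "k \<in> Z" "l \<in> Z"
    "0 < of_int k * x - of_int l * x - of_int j" "of_int k * x - of_int l * x - of_int j < \<delta>"
    using small_differences_mod1[OF Z] by blast
  define \<eta> where "\<eta> = of_int k * x - of_int l * x - of_int j"
  have eta: "0 < \<eta>" "\<eta> < \<delta>" using klj by (auto simp: \<eta>_def)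
  \<comment> \<open>The representative of \<open>t\<close> in [1, 2): the lower bound gives
    \<open>t' / \<eta> \<ge> M\<close>, and the upper bound turns the relative error
    \<open>e / 3\<close> into an absolute error below \<open>e\<close>.\<close>
  define t' where "t' = 1 + frac t"
  have t': "1 \<le> t'" "t' < 2" using frac_lt_1[of t] by (auto simp: t'_def)
  have "M * \<eta> \<le> max M 1 * \<eta>" using eta by (intro mult_right_mono) auto
  also have "\<dots> \<le> max M 1 * \<delta>" using eta by (intro mult_left_mono) auto
  also have "\<dots> = 1" by (simp add: \<delta>_def)
  finally have "M \<le> 1 / \<eta>" using eta by (simp add: pos_le_divide_eq)
  also have "\<dots> \<le> t' / \<eta>" using t' eta by (simp add: divide_simps)
  finally obtain n where n: "n \<ge> 1" "t' / \<eta> \<le> real (a n)" "real (a n) \<le> (1 + e / 3) * (t' / \<eta>)"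
    using M by blast
  have 1: "t' \<le> real (a n) * \<eta>" using n(2) eta by (simp add: divide_simps)
  have "real (a n) * \<eta> \<le> (1 + e / 3) * t'" using n(3) eta by (simp add: field_simps)
  moreover have "(e / 3) * t' < e" using t' \<open>e > 0\<close> by simp
  ultimately have "\<bar>real (a n) * \<eta> - t'\<bar> < e" using 1 by (simp add: algebra_simps)
  moreover have "real (a n) * \<eta> - t' = real (a n) * of_int k * x - real (a n) * of_int l * x - t
      - of_int (int (a n) * j + 1 - \<lfloor>t\<rfloor>)"
    by (simp add: \<eta>_def t'_def frac_def algebra_simps)
  ultimately have "\<bar>real (a n) * of_int k * x - real (a n) * of_int l * x - t
      - of_int (int (a n) * j + 1 - \<lfloor>t\<rfloor>)\<bar> < e"
    by (simp only:)
  then show ?thesis using n(1) klj(1,2) by blast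
qed

section \<open>Counting the cells that meet \<open>Y\<close>\<close>

lemma card_le_fibres:
  assumes "finite T" "f ` W \<subseteq> T" "\<And>t. t \<in> T \<Longrightarrow> card {w \<in> W. f w = t} \<le> k"
  shows "card W \<le> k * card T"
proof -
  have "W = (\<Union>t\<in>T. {w \<in> W. f w = t})" using assms(2) by auto
  then have "card W \<le> (\<Sum>t\<in>T. card {w \<in> W. f w = t})" using card_UN_le[OF assms(1)] by metis
  also have "\<dots> \<le> card T * k" using sum_bounded_above[OF assms(3)] by simp
  finally show ?thesis by (simp add: mult.commute)
qed

definition cells :: "real set \<Rightarrow> nat \<Rightarrow> int set"
  where "cells Y N = (\<lambda>y. \<lfloor>real N * frac y\<rfloor>) ` Y"

lemma cells_subset: "N > 0 \<Longrightarrow> cells Y N \<subseteq> {0..<int N}"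
  using frac_lt_1 by (auto simp: cells_def floor_less_iff)

lemma card_cells_le: "N > 0 \<Longrightarrow> card (cells Y N) \<le> N"
  using card_mono[OF _ cells_subset[of N Y]] by simp

lemma finite_cells: "N > 0 \<Longrightarrow> finite (cells Y N)"
  using finite_subset[OF cells_subset[of N Y]] by simp

text \<open>Each residue modulo \<open>N\<close> is a difference of two occupied indices up to a
  carry of 0 or 1, so pairs and carries together number at least \<open>N\<close>.\<close>

lemma card_cells_ge:
  fixes Y :: "real set"
  assumes dense: "\<And>t e. e > 0 \<Longrightarrow> \<exists>y\<in>Y. \<exists>y'\<in>Y. \<exists>j::int. \<bar>y - y' - t - of_int j\<bar> < e"
    and N: "N > 0"
  shows "N \<le> 2 * (card (cells Y N))\<^sup>2"
proof -
  let ?S = "cells Y N"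
  let ?g = "\<lambda>(p, q, r). (p - q - r) mod int N"
  have "{0..<int N} \<subseteq> ?g ` (?S \<times> ?S \<times> {0, 1})"
  proof
    fix i assume i: "i \<in> {0..<int N}"
    \<comment> \<open>The midpoint of cell \<open>i\<close>: with an error below half a cell, the
      difference stays inside that cell modulo 1.\<close>
    define t where "t = (of_int i + 1/2) / real N"
    have t: "real N * t = of_int i + 1/2" using N by (simp add: t_def)
    obtain y y' j where y: "y \<in> Y" "y' \<in> Y"
      and j: "\<bar>y - y' - t - of_int j\<bar> < 1 / (2 * real N)"
      using dense[of "1 / (2 * real N)" t] N by auto
    define z where "z = real N * frac y"
    define z' where "z' = real N * frac y'"
    define k where "k = j + \<lfloor>y'\<rfloor> - \<lfloor>y\<rfloor>"
    have "\<bar>real N * (y - y' - t - of_int j)\<bar> < real N * (1 / (2 * real N))"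
      unfolding abs_mult abs_of_nat using j N by (intro mult_strict_left_mono) auto
    moreover have "real N * (y - y' - t - of_int j) = z - z' - of_int i - 1/2 - of_int (int N * k)"
      using t by (simp add: z_def z'_def k_def frac_def algebra_simps)
    ultimately have "\<bar>z - z' - of_int i - 1/2 - of_int (int N * k)\<bar> < 1/2" using N by simp
    then have "\<lfloor>z\<rfloor> - \<lfloor>z'\<rfloor> - 0 = i + int N * k \<or> \<lfloor>z\<rfloor> - \<lfloor>z'\<rfloor> - 1 = i + int N * k"
      by linarith
    then obtain r where "r \<in> {0, 1}" "\<lfloor>z\<rfloor> - \<lfloor>z'\<rfloor> - r = i + int N * k" by blast
    moreover have "\<lfloor>z\<rfloor> \<in> ?S" "\<lfloor>z'\<rfloor> \<in> ?S" using y by (auto simp: cells_def z_def z'_def)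
    ultimately show "i \<in> ?g ` (?S \<times> ?S \<times> {0, 1})"
      using i by (intro image_eqI[of _ _ "(\<lfloor>z\<rfloor>, \<lfloor>z'\<rfloor>, r)"]) auto
  qed
  then have "card {0..<int N} \<le> card (?S \<times> ?S \<times> {0, 1::int})"
    using finite_cells[OF N] by (intro surj_card_le) auto
  then show ?thesis by (simp add: card_cartesian_product power2_eq_square algebra_simps)
qed

text \<open>Otherwise each level beyond \<open>n\<^sub>0\<close> multiplies the number of occupied
  cells by at most \<open>K\<close>, whereas \<open>card_cells_ge\<close> forces growth like powers
  of the square root of \<open>D\<close>, which exceeds \<open>K\<close> by a factor of the square
  root of 2.\<close>

lemma cell_with_many_children:
  fixes Y :: "real set" and K D n\<^sub>0 :: nat
  assumes dense: "\<And>t e. e > 0 \<Longrightarrow> \<exists>y\<in>Y. \<exists>y'\<in>Y. \<exists>j::int. \<bar>y - y' - t - of_int j\<bar> < e"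
    and K: "K > 0" and D: "D = 2 * K\<^sup>2"
  obtains n i where "n \<ge> n\<^sub>0" "card {p \<in> cells Y (D ^ Suc n). p div int D = i} > K"
proof (rule ccontr)
  assume contra: "\<not> thesis"
  note witness = that
  have few: "card {p \<in> cells Y (D ^ Suc n). p div int D = i} \<le> K" if "n \<ge> n\<^sub>0" for n i
    using witness[OF that] contra leI by blast
  have D0: "D > 0" using K D by simp
  have parent: "(\<lambda>p. p div int D) ` cells Y (D ^ Suc n) \<subseteq> cells Y (D ^ n)" for n
  proof -
    have "\<lfloor>real (D ^ Suc n) * frac y\<rfloor> div int D = \<lfloor>real (D ^ n) * frac y\<rfloor>" for y
      using floor_divide_real_eq_div[of "int D" "real (D ^ Suc n) * frac y"] D0 by simp
    then show ?thesis by (auto simp: cells_def)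
  qed
  have step: "card (cells Y (D ^ Suc n)) \<le> K * card (cells Y (D ^ n))" if "n \<ge> n\<^sub>0" for n
    using card_le_fibres[OF finite_cells parent few[OF that]] D0 by simp
  have bound: "card (cells Y (D ^ (n\<^sub>0 + j))) \<le> K ^ j * D ^ n\<^sub>0" for j
  proof (induction j)
    case 0 then show ?case using card_cells_le[of "D ^ n\<^sub>0" Y] D0 by simp
  next
    case (Suc j)
    have "card (cells Y (D ^ (n\<^sub>0 + Suc j))) \<le> K * card (cells Y (D ^ (n\<^sub>0 + j)))"
      using step[of "n\<^sub>0 + j"] by simp
    also have "\<dots> \<le> K * (K ^ j * D ^ n\<^sub>0)" using Suc by simp
    finally show ?case by (simp add: mult.assoc)
  qed
  \<comment> \<open>After cancellation the two bounds leave
    \<open>2 ^ j \<le> 2 * D ^ n\<^sub>0\<close>; with this \<open>j\<close> the right side is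
    \<open>j\<close> itself.\<close>
  define j where "j = 2 * D ^ n\<^sub>0"
  have "(D ^ n\<^sub>0 * (K\<^sup>2) ^ j) * 2 ^ j = D ^ (n\<^sub>0 + j)"
    by (simp only: power_add) (simp only: D power_mult_distrib mult_ac)
  also have "\<dots> \<le> 2 * (card (cells Y (D ^ (n\<^sub>0 + j))))\<^sup>2"
    using card_cells_ge[OF dense] D0 by simp
  also have "\<dots> \<le> 2 * (K ^ j * D ^ n\<^sub>0)\<^sup>2"
    using bound[of j] by (intro mult_le_mono2 power_mono) auto
  also have "\<dots> = (D ^ n\<^sub>0 * (K\<^sup>2) ^ j) * (2 * D ^ n\<^sub>0)"
  proof -
    have "(K ^ j)\<^sup>2 = (K\<^sup>2) ^ j" by (simp add: mult.commute flip: power_mult)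
    then show ?thesis
      by (simp only: power_mult_distrib power2_eq_square[of "D ^ n\<^sub>0"] mult_ac)
  qed
  finally have "(D ^ n\<^sub>0 * (K\<^sup>2) ^ j) * 2 ^ j \<le> (D ^ n\<^sub>0 * (K\<^sup>2) ^ j) * (2 * D ^ n\<^sub>0)" .
  moreover have "D ^ n\<^sub>0 * (K\<^sup>2) ^ j > 0" using D0 K by simp
  ultimately have "2 ^ j \<le> j" unfolding j_def using mult_le_cancel1 by blast
  then show False using less_exp[of j] by simp
qed

section \<open>Dilations that hit prescribed targets\<close>

text \<open>As \<open>r\<close> runs through the interval, \<open>r * g\<close> sweeps a length of
  at least 1, starting from its minimum \<open>m\<close>, and so meets every class modulo 1.\<close>

lemma dilate_hits:
  fixes g h s \<theta> :: real
  assumes "h * \<bar>g\<bar> \<ge> 1" "h \<ge> 0"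
  obtains r and j :: int where "s \<le> r" "r \<le> s + h" "r * g = \<theta> + of_int j"
proof -
  define m where "m = (if g > 0 then s * g else (s + h) * g)"
  define j where "j = \<lceil>m - \<theta>\<rceil>"
  have g: "g \<noteq> 0" using assms by auto
  have j: "m \<le> \<theta> + of_int j" "\<theta> + of_int j \<le> m + 1" unfolding j_def by linarith+
  show ?thesis
  proof (rule that)
    show "(\<theta> + of_int j) / g * g = \<theta> + of_int j" using g by simp
    show "s \<le> (\<theta> + of_int j) / g"
      using j assms g by (cases "g > 0") (auto simp: m_def field_simps)
    show "(\<theta> + of_int j) / g \<le> s + h"
      using j assms g by (cases "g > 0") (auto simp: m_def field_simps)
  qed
qed

text \<open>Induction on the number of targets. A cluster of \<open>M ^ p\<close> points serves the
  first \<open>p\<close> targets on a long window of dilations; a point far from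
  \<open>w\<^sub>0\<close> serves the last target on a short subwindow. Distinct floors prevent the
  clusters from shrinking below the unit scale.\<close>

lemma dilations_hit_targets:
  fixes W :: "real set" and \<theta> :: "nat \<Rightarrow> real" and M :: nat
  assumes e: "0 < e" "e \<le> 1" and M: "real M \<ge> 2 + 4 / e"
    and "finite W" "inj_on floor W" "W \<subseteq> {u..u + d}" "d \<ge> 1" "card W \<ge> M ^ p"
  shows "\<exists>w\<^sub>0\<in>W. \<exists>s\<ge>1. s + e / d \<le> 1 + e \<and>
    (\<forall>r\<in>{s..s + e / d}. \<forall>i<p. \<exists>w\<in>W. \<exists>j::int. \<bar>r * (w - w\<^sub>0) - \<theta> i - of_int j\<bar> \<le> e)"
  using assms(4-)
proof (induction p arbitrary: W u d)
  case 0
  then obtain w where "w \<in> W" by fastforce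
  moreover have "e / d \<le> e" using e 0 by (simp add: divide_simps)
  ultimately show ?case by (intro bexI[of _ w] exI[of _ 1]) auto
next
  case (Suc p)
  have M6: "real M \<ge> 6" proof -
    have "4 \<le> 4 / e" using e by (simp add: field_simps)
    then show ?thesis using M by linarith
  qed
  then have M0: "M \<ge> 6" by linarith
  have "M \<le> M ^ Suc p" using M0 by simp
  then have cW: "card W \<ge> M" using Suc.prems(5) by (rule order_trans)
  then have ne: "W \<noteq> {}" using M0 by auto
  define v where "v = Min W"
  define d' where "d' = Max W - Min W"
  have vW: "v \<in> W" "v + d' \<in> W" using ne Suc.prems(1) by (auto simp: v_def d'_def)
  have W: "W \<subseteq> {v..v + d'}" using Suc.prems(1) by (auto simp: v_def d'_def)
  have d'd: "d' \<le> d" using subsetD[OF Suc.prems(3) vW(1)] subsetD[OF Suc.prems(3) vW(2)] by simp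
  have "card W = card (floor ` W)" using Suc.prems(2) by (simp add: card_image)
  also have "\<dots> \<le> card {\<lfloor>v\<rfloor>..\<lfloor>v + d'\<rfloor>}"
    using W by (intro card_mono) (auto intro!: floor_mono)
  also have "\<dots> = nat (\<lfloor>v + d'\<rfloor> - \<lfloor>v\<rfloor> + 1)" by simp
  finally have d'M: "d' \<ge> real M - 2" using cW M0 by linarith
  \<comment> \<open>This length is at least 1, as the induction hypothesis requires, and gives
    \<open>M - 1\<close> pieces, the last one catching the right endpoint.\<close>
  define \<delta> where "\<delta> = d' / (real M - 2)"
  have \<delta>: "\<delta> \<ge> 1" using d'M M6 by (simp add: \<delta>_def)
  have d'0: "d' > 0" using d'M M6 by simp
  define f where "f = (\<lambda>w. \<lfloor>(w - v) / \<delta>\<rfloor>)"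
  have "f ` W \<subseteq> {0..int M - 2}"
  proof safe
    fix w assume "w \<in> W"
    then have w: "v \<le> w" "w \<le> v + d'" using W by auto
    have "(w - v) / \<delta> \<le> d' / \<delta>" using w \<delta> by (intro divide_right_mono) auto
    also have "\<dots> = of_int (int M - 2)" using d'0 by (simp add: \<delta>_def)
    finally have "f w \<le> int M - 2" unfolding f_def by linarith
    then show "f w \<in> {0..int M - 2}" using w \<delta> by (simp add: f_def)
  qed
  moreover have "card {0..int M - 2} \<le> M" by simp
  moreover have "\<not> card W \<le> (M ^ p - 1) * M"
  proof -
    have "(M ^ p - 1) * M < M ^ p * M" using M0 by (intro mult_strict_right_mono) auto
    also have "\<dots> \<le> card W" using Suc.prems(5) by (simp add: mult.commute)
    finally show ?thesis by (simp only: not_le)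
  qed
  ultimately obtain t where t: "\<not> card {w \<in> W. f w = t} \<le> M ^ p - 1"
    using card_le_fibres[of "{0..int M - 2}" f W "M ^ p - 1"]
    by (meson finite_atLeastAtMost_int le_trans mult_le_mono2)
  define W' where "W' = {w \<in> W. f w = t}"
  have W'sub: "W' \<subseteq> {v + of_int t * \<delta>..v + of_int t * \<delta> + \<delta>}"
  proof
    fix w assume "w \<in> W'"
    then have "of_int t \<le> (w - v) / \<delta>" "(w - v) / \<delta> < of_int t + 1" by (auto simp: W'_def f_def)
    then show "w \<in> {v + of_int t * \<delta>..v + of_int t * \<delta> + \<delta>}" using \<delta> by (simp add: field_simps)
  qed
  have W': "finite W'" "inj_on floor W'" "card W' \<ge> M ^ p"
    using Suc.prems t by (auto simp: W'_def intro: inj_on_subset)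
  obtain w\<^sub>0 s where w\<^sub>0: "w\<^sub>0 \<in> W'" and s: "s \<ge> 1" "s + e / \<delta> \<le> 1 + e"
    and hits: "\<And>r i. r \<in> {s..s + e / \<delta>} \<Longrightarrow> i < p \<Longrightarrow>
      \<exists>w\<in>W'. \<exists>j::int. \<bar>r * (w - w\<^sub>0) - \<theta> i - of_int j\<bar> \<le> e"
    using Suc.IH[OF W'(1,2) W'sub \<delta> W'(3)] by blast
  have w\<^sub>0W: "w\<^sub>0 \<in> W" using w\<^sub>0 by (simp add: W'_def)
  then have w\<^sub>0b: "v \<le> w\<^sub>0" "w\<^sub>0 \<le> v + d'" using W by auto
  \<comment> \<open>One of the extreme points \<open>v\<close> and \<open>v + d'\<close> is at least
    half the spread away from \<open>w\<^sub>0\<close>.\<close>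
  then obtain w where w: "w \<in> W" "\<bar>w - w\<^sub>0\<bar> \<ge> d' / 2" "\<bar>w - w\<^sub>0\<bar> \<le> d'"
    using vW by (cases "w\<^sub>0 \<le> v + d' / 2") force+
  \<comment> \<open>The first half of the window is used to hit target \<open>p\<close> exactly, for
    which \<open>M \<ge> 2 + 4 / e\<close> is just enough; the second half leaves room for the new
    window of length \<open>e / d\<close>.\<close>
  define h where "h = e / \<delta> / 2"
  have h: "h = e * (real M - 2) / (2 * d')" by (simp add: h_def \<delta>_def)
  have "1 \<le> e * (real M - 2) / 4" proof -
    have "4 / e \<le> real M - 2" using M by linarith
    then show ?thesis using e by (simp add: divide_le_eq mult.commute)
  qed
  also have "\<dots> = h * (d' / 2)" using d'0 by (simp add: h)
  also have "\<dots> \<le> h * \<bar>w - w\<^sub>0\<bar>" using w(2) e \<delta> by (intro mult_left_mono) (auto simp: h_def)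
  finally have "h * \<bar>w - w\<^sub>0\<bar> \<ge> 1" .
  then obtain r' and j' :: int where r': "s \<le> r'" "r' \<le> s + h" "r' * (w - w\<^sub>0) = \<theta> p + of_int j'"
    using dilate_hits[of h "w - w\<^sub>0" s "\<theta> p"] e \<delta> by (auto simp: h_def)
  have "e * 2 \<le> e * (real M - 2)" using e M6 by (intro mult_left_mono) auto
  then have "e / d' \<le> h" using d'0 by (simp add: h divide_simps)
  moreover have ed: "e / d \<le> e / d'" using d'd d'0 e by (intro divide_left_mono) auto
  ultimately have top: "r' + e / d \<le> s + e / \<delta>" using r'(2) by (simp add: h_def)
  have "\<exists>w\<in>W. \<exists>j::int. \<bar>r * (w - w\<^sub>0) - \<theta> i - of_int j\<bar> \<le> e"
    if r: "r \<in> {r'..r' + e / d}" and i: "i < Suc p" for r i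
  proof (cases "i = p")
    case True
    \<comment> \<open>Over the new window the product drifts from its exact hit by at most
      \<open>(e / d') * d' = e\<close>.\<close>
    have "r * (w - w\<^sub>0) - \<theta> p - of_int j' = (r - r') * (w - w\<^sub>0)"
      using r'(3) by (simp add: algebra_simps)
    moreover have "\<bar>(r - r') * (w - w\<^sub>0)\<bar> \<le> (e / d') * d'"
      unfolding abs_mult using r ed w(3) e d'0 by (intro mult_mono) auto
    ultimately show ?thesis using w(1) True d'0 by (metis less_irrefl nonzero_divide_eq_eq)
  next
    case False
    then show ?thesis using hits[of r i] r r'(1) top i by (force simp: W'_def)
  qed
  moreover have "r' \<ge> 1" "r' + e / d \<le> 1 + e" using r'(1) s top by simp_all
  ultimately show ?case using w\<^sub>0W by blast
qed

section \<open>Approximation of an arbitrary point modulo 1\<close>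

lemma infinite_range_if_unbounded:
  fixes c :: "nat \<Rightarrow> int"
  assumes "\<not> bdd_above ((\<lambda>k. \<bar>c k\<bar>) ` A)"
  shows "infinite (c ` A)"
proof
  assume "finite (c ` A)"
  then have "finite (abs ` c ` A)" by simp
  then show False using assms by (simp add: image_image)
qed

theorem theorem1p1:
  fixes a b :: "nat \<Rightarrow> nat" and c :: "nat \<Rightarrow> int" and x :: real
  assumes "\<And>n. n \<ge> 1 \<Longrightarrow> a n \<ge> 1"
    and "\<And>m. m \<ge> 1 \<Longrightarrow> b m \<ge> 1"
    and "strict_mono_on {1..} a"
    and "strict_mono_on {1..} b"
    and "(\<lambda>n. real (a (n + 1)) / real (a n)) \<longlonglongrightarrow> 1"
    and "(\<lambda>m. real (b (m + 1)) / real (b m)) \<longlonglongrightarrow> 1"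
    and "\<not> bdd_above ((\<lambda>k. \<bar>c k\<bar>) ` {1..})"
    and "x \<notin> \<rat>"
  shows "dense_mod1
    {real (a n) * real (b m) * of_int (c k) * x | n m k. n \<ge> 1 \<and> m \<ge> 1 \<and> k \<ge> 1}"
  unfolding dense_mod1_iff
proof (intro allI impI)
  fix \<tau> \<epsilon> :: real assume "\<epsilon> > 0"
  define Y where "Y = {real (a n) * of_int (c k) * x | n k. n \<ge> 1 \<and> k \<ge> 1}"
  have dense: "\<exists>y\<in>Y. \<exists>y'\<in>Y. \<exists>j::int. \<bar>y - y' - t - of_int j\<bar> < e" if "e > 0" for t e
  proof -
    have "infinite (c ` {1..})" using assms(7) by (rule infinite_range_if_unbounded)
    from differences_dense_mod1[OF assms(1,3,5) this assms(8) \<open>e > 0\<close>, of t]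
    obtain n k l and j :: int where "n \<ge> 1" "k \<ge> 1" "l \<ge> 1"
      "\<bar>real (a n) * of_int (c k) * x - real (a n) * of_int (c l) * x - t - of_int j\<bar> < e"
      by auto
    then show ?thesis unfolding Y_def by blast
  qed
  \<comment> \<open>One \<open>e\<close> pays for the inexact hit, another for the spacing of the
    targets \<open>i * e\<close>; \<open>p\<close> of these reach across [0, 1).\<close>
  define e where "e = min 1 (\<epsilon> / 3)"
  have e: "0 < e" "e \<le> 1" "2 * e < \<epsilon>" using \<open>\<epsilon> > 0\<close> by (auto simp: e_def)
  define M where "M = nat \<lceil>2 + 4 / e\<rceil>"
  define p where "p = nat \<lceil>1 / e\<rceil>"
  define K where "K = M ^ p"
  define D where "D = 2 * K\<^sup>2"
  have M: "real M \<ge> 2 + 4 / e" unfolding M_def by linarith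
  then have "real M > 0" using e by (smt (verit) divide_nonneg_nonneg)
  then have K: "K > 0" by (simp add: K_def)
  then have D2: "D \<ge> 2" by (simp add: D_def)
  then have D: "D > 0" and D1: "real D \<ge> 1" by simp_all
  obtain B where B: "\<And>u. u \<ge> B \<Longrightarrow>
      \<exists>m\<ge>1. u \<le> real (b m) \<and> real (b m) \<le> (1 + e / (2 * real D)) * u"
    using slowly_growing_hits[OF assms(2,4,6), of "e / (2 * real D)"] e D by auto
  obtain n i where n: "n \<ge> nat \<lceil>B\<rceil>" and many: "card {q \<in> cells Y (D ^ Suc n). q div int D = i} > K"
    using cell_with_many_children[OF dense K D_def] by blast
  define N where "N = real (D ^ Suc n)"
  have "N \<ge> B"
  proof -
    have "n < D ^ n" using D2 by (simp add: power_gt_expt)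
    also have "D ^ n \<le> D ^ Suc n" using D by simp
    finally have "real n < N" unfolding N_def by (rule of_nat_less_iff[THEN iffD2])
    then show ?thesis using n by linarith
  qed
  have N: "N > 0" using D by (simp add: N_def)
  define Q where "Q = {q \<in> cells Y (D ^ Suc n). q div int D = i}"
  have "\<forall>q\<in>Q. \<exists>y\<in>Y. \<lfloor>N * frac y\<rfloor> = q" by (auto simp: Q_def cells_def N_def)
  then obtain g where g: "\<And>q. q \<in> Q \<Longrightarrow> g q \<in> Y \<and> \<lfloor>N * frac (g q)\<rfloor> = q" by metis
  \<comment> \<open>One point per occupied child, rescaled so that children have length 1 and their
    parent length \<open>D\<close>.\<close>
  define W where "W = (\<lambda>q. N * frac (g q)) ` Q"
  have finW: "finite W" unfolding W_def Q_def using finite_cells D by simp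
  have injW: "inj_on floor W" using g by (auto simp: W_def inj_on_def)
  have "inj_on (\<lambda>q. N * frac (g q)) Q" using g by (intro inj_on_inverseI[of _ floor]) auto
  then have cardW: "card W \<ge> M ^ p" using many by (simp add: W_def card_image Q_def K_def)
  have subW: "W \<subseteq> {of_int (i * int D)..of_int (i * int D) + real D}"
  proof
    fix w assume "w \<in> W"
    then have "\<lfloor>w\<rfloor> div int D = i" using g by (auto simp: W_def Q_def)
    then have "\<lfloor>w\<rfloor> = i * int D + \<lfloor>w\<rfloor> mod int D" by (metis div_mult_mod_eq)
    moreover have "0 \<le> \<lfloor>w\<rfloor> mod int D" "\<lfloor>w\<rfloor> mod int D < int D" using D by simp_all
    ultimately have "i * int D \<le> \<lfloor>w\<rfloor>" "\<lfloor>w\<rfloor> < i * int D + int D" by linarith+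
    then show "w \<in> {of_int (i * int D)..of_int (i * int D) + real D}"
      by (simp add: le_floor_iff floor_less_iff)
  qed
  obtain w\<^sub>0 s where w\<^sub>0: "w\<^sub>0 \<in> W" and s: "s \<ge> 1" "s + e / real D \<le> 1 + e"
    and hits: "\<And>r i. r \<in> {s..s + e / real D} \<Longrightarrow> i < p \<Longrightarrow>
      \<exists>w\<in>W. \<exists>j::int. \<bar>r * (w - w\<^sub>0) - of_nat i * e - of_int j\<bar> \<le> e"
    using dilations_hit_targets[OF e(1,2) M finW injW subW D1 cardW, of "\<lambda>i. of_nat i * e"]
    by blast
  have "N * s \<ge> B"
    using \<open>N \<ge> B\<close> mult_left_mono[OF s(1), of N] N by linarith
  then obtain m where m: "m \<ge> 1" "N * s \<le> real (b m)" "real (b m) \<le> (1 + e / (2 * real D)) * (N * s)"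
    using B by blast
  \<comment> \<open>Rescaling by \<open>N\<close> turns \<open>b m\<close> into a dilation in the
    window: since \<open>s \<le> 2\<close>, the relative error \<open>e / (2 * D)\<close> costs at
    most \<open>e / D\<close>.\<close>
  define r where "r = real (b m) / N"
  have "s \<le> r" using m(2) N by (simp add: r_def field_simps)
  moreover have "r \<le> s + e / real D"
  proof -
    have "r \<le> (1 + e / (2 * real D)) * s" using m(3) N by (simp add: r_def field_simps)
    also have "\<dots> = s + e / real D * (s / 2)" by (simp add: algebra_simps)
    also have "\<dots> \<le> s + e / real D * 1"
    proof -
      have "s \<le> 2" using s e divide_nonneg_nonneg[of e "real D"] by linarith
      then show ?thesis using e by (intro add_left_mono mult_left_mono) auto
    qed
    finally show ?thesis by simp
  qed
  ultimately have r: "r \<in> {s..s + e / real D}" by simp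
  \<comment> \<open>The value that \<open>r * (w - w\<^sub>0)\<close> should take modulo 1 for
    \<open>r * w\<close> to reach \<open>\<tau>\<close>; \<open>i'\<close> picks the last target not
    above it.\<close>
  define \<phi> where "\<phi> = frac (\<tau> - r * w\<^sub>0)"
  define i' where "i' = nat \<lfloor>\<phi> / e\<rfloor>"
  have \<phi>: "0 \<le> \<phi>" "\<phi> < 1" using frac_lt_1 by (auto simp: \<phi>_def)
  have i': "real i' \<le> \<phi> / e" "\<phi> / e < real i' + 1"
    using \<phi> e unfolding i'_def by (auto simp: of_nat_nat)
  have "\<phi> / e < 1 / e" using \<phi> e by (intro divide_strict_right_mono) auto
  then have "i' < p" using i' unfolding p_def by linarith
  with hits[OF r] obtain w j where w: "w \<in> W" "\<bar>r * (w - w\<^sub>0) - of_nat i' * e - of_int j\<bar> \<le> e"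
    by blast
  have "\<bar>of_nat i' * e - \<phi>\<bar> \<le> e" using i' e by (auto simp: field_simps)
  then have close: "\<bar>r * w - \<tau> - of_int (j - \<lfloor>\<tau> - r * w\<^sub>0\<rfloor>)\<bar> < \<epsilon>"
    using w(2) e(3) unfolding \<phi>_def frac_def by (simp add: algebra_simps)
  obtain q where q: "q \<in> Q" "w = N * frac (g q)" using w(1) by (auto simp: W_def)
  then obtain n' k where nk: "n' \<ge> 1" "k \<ge> 1" "g q = real (a n') * of_int (c k) * x"
    using g[of q] by (auto simp: Y_def)
  \<comment> \<open>The scale \<open>N\<close> cancels, and as \<open>b m\<close> is an integer,
    replacing \<open>g q\<close> by its fractional part changes the product only by an
    integer.\<close>
  have "r * w = real (b m) * g q - of_int (int (b m) * \<lfloor>g q\<rfloor>)"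
    using N by (simp add: r_def q(2) frac_def algebra_simps)
  then have "\<bar>real (a n') * real (b m) * of_int (c k) * x - \<tau>
      - of_int (j - \<lfloor>\<tau> - r * w\<^sub>0\<rfloor> + int (b m) * \<lfloor>g q\<rfloor>)\<bar> < \<epsilon>"
    using close by (simp add: nk(3) algebra_simps)
  then show "\<exists>z\<in>{real (a n) * real (b m) * of_int (c k) * x | n m k. n \<ge> 1 \<and> m \<ge> 1 \<and> k \<ge> 1}.
      \<exists>j::int. \<bar>z - \<tau> - of_int j\<bar> < \<epsilon>"
    using nk m(1) by blast
qed

end
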